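(* Let $1\le k\le n$ and let $c=(c_0,\dots,c_{n-1})$ be positive speeds with $1=c_0\ge c_1\ge\dots\ge c_{n-1}$. If the geometric mean $\left(\prod_{i=0}^{n-1}c_i\right)^{1/n}$ of the $n$ agents' speeds is at least $\mathcal U_n/\mathcal U_k$, then searching for a point in the plane with $n$ agents of speeds $c$ (the problem $\mathcal P\text{-MSP}_n(c)$) can be performed faster than searching with $k$ unit-speed agents, that is, with search cost below $\mathcal U_k$, where $\mathcal U_i$ is the search cost for $i$ unit-speed agents given in the context.
   Context: For a positive integer $i$, $\kappa_i$ is the unique positive root $x$ of $x^3+x=\frac{i}{2\pi}$ and $\mathcal U_i=\frac{\sqrt{1+\kappa_i^2}}{\kappa_i}e^{2\pi\kappa_i/i}$; $\mathcal U_i$ is a search cost achievable for searching the plane with $i$ unit-speed agents (by symmetric logarithmic spirals), and is what is meant by "the search cost for $i$ unit-speed agents". Polar notation: $\langle \rho,\chi\rangle = \rho(\cos\chi,\sin\chi)$. A point $P=\langle x,\psi\rangle$ exposes $A=\langle y,\psi\rangle$ (with $x,y>0$, same ray from the origin) if $x\ge y$. $[n]=\{0,\dots,n-1\}$. $\mathcal P=\mathbb R^2\setminus\{(0,0)\}$. Problem $\mathcal D\text{-MSP}_n(c)$, for a search domain $\mathcal D\subseteq\mathbb R^2\setminus\{(0,0)\}$ and speeds $c=(c_0,\dots,c_{n-1})$: a feasible solution consists of continuous, piecewise differentiable curves $\tau_i:\mathbb R\to\mathbb R^2$, $i\in[n]$, with $\lim_{t\to-\infty}\tau_i(t)=(0,0)$,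 such that every $A\in\mathcal D$ is exposed by some point $\tau_i(t)$ of some curve. The parameter $t$ is not physical time: agent $i$ moves along $\tau_i$ at speed $c_i$, so it reaches $\tau_i(t)$ at time $\ell_i(t)/c_i$, where $\ell_i(t)=\int_{-\infty}^t\|\tau_i'(u)\|\,du$. If $t_A^i$ is the earliest parameter at which $\tau_i(t_A^i)$ exposes $A$ (infinite if none), the search cost of the solution is $\sup_{A\in\mathcal D}\frac1{\|A\|}\min_{i\in[n]}\frac{\ell_i(t_A^i)}{c_i}$.
   Formalization: If the geometric mean equals U_n/U_k exactly, only search cost at most U_k is claimed, with each single target found at ratio strictly below U_k; cost below U_k is claimed when the mean exceeds U_n/U_k. For k=n=1 the original fails, since the logarithmic spiral is optimal. *)

theory Defs
  imports "HOL-Analysis.Analysis"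
begin

definition kappa :: "nat \<Rightarrow> real" where
  "kappa i = (THE x. x > 0 \<and> x ^ 3 + x = real i / (2 * pi))"

lemma kappa_ex1:
  assumes "i \<ge> 1"
  shows "\<exists>!x::real. x > 0 \<and> x ^ 3 + x = real i / (2 * pi)"
proof (rule ex_ex1I)
  let ?b = "real i / (2 * pi)"
  have b: "?b > 0" using assms by simp
  have "\<exists>x\<ge>0. x \<le> ?b \<and> x ^ 3 + x = ?b"
  proof (rule IVT)
    show "0 ^ 3 + 0 \<le> ?b" "?b \<le> ?b ^ 3 + ?b" using b by auto
  qed (use b in auto)
  then obtain x where x: "x \<ge> 0" "x ^ 3 + x = ?b" by auto
  then have "x \<noteq> 0" using b by auto
  with x show "\<exists>x. x > 0 \<and> x ^ 3 + x = ?b" by (intro exI[of _ x]) auto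
next
  fix x y :: real
  assume "x > 0 \<and> x ^ 3 + x = real i / (2 * pi)" "y > 0 \<and> y ^ 3 + y = real i / (2 * pi)"
  then have eq: "x ^ 3 + x = y ^ 3 + y" and "x > 0" "y > 0" by auto
  then show "x = y"
    using power_strict_mono[of x y 3] power_strict_mono[of y x 3]
    by (cases x y rule: linorder_cases) auto
qed

definition unit_cost :: "nat \<Rightarrow> real" where
  "unit_cost i = sqrt (1 + kappa i ^ 2) / kappa i * exp (2 * pi * kappa i / real i)"

definition polar :: "real \<Rightarrow> real \<Rightarrow> real \<times> real" where
  "polar r \<phi> = r *\<^sub>R (cos \<phi>, sin \<phi>)"

definition exposes :: "real \<times> real \<Rightarrow> real \<times> real \<Rightarrow> bool" where
  "exposes P A \<longleftrightarrow>
     (\<exists>x y \<psi>. x > 0 \<and> y > 0 \<and> x \<ge> y \<and> P = polar x \<psi> \<and> A = polar y \<psi>)"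

definition punctured_plane :: "(real \<times> real) set" where
  "punctured_plane = UNIV - {(0, 0)}"

text \<open>A search trajectory is parametrized by the whole real line; breakpoints need only be
  locally finite, so that infinitely many turns are allowed.\<close>

definition trajectory :: "(real \<Rightarrow> real \<times> real) \<Rightarrow> bool" where
  "trajectory \<tau> \<longleftrightarrow>
     continuous_on UNIV \<tau> \<and>
     (\<forall>a b. \<tau> piecewise_differentiable_on {a..b}) \<and>
     (\<tau> \<longlongrightarrow> (0, 0)) at_bot"

text \<open>Lengths, times and costs are extended nonnegative reals, so that an infinite length is
  not identified with \<open>0\<close>. The values of \<^const>\<open>vector_derivative\<close> at the
  countably many breakpoints do not affect the integral.\<close>

definition path_len :: "(real \<Rightarrow> real \<times> real) \<Rightarrow> real \<Rightarrow> ennreal" where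
  "path_len \<tau> t =
     (\<integral>\<^sup>+ u\<in>{..t}. ennreal (norm (vector_derivative \<tau> (at u))) \<partial>lborel)"

text \<open>The time at which an agent of the given speed first exposes \<open>A\<close>; it is \<open>\<infinity>\<close> if the agent
  never does so, even if its whole trajectory has finite length.\<close>

definition exposure_time :: "(real \<Rightarrow> real \<times> real) \<Rightarrow> real \<Rightarrow> real \<times> real \<Rightarrow> ennreal" where
  "exposure_time \<tau> speed A =
     (if \<exists>t. exposes (\<tau> t) A
      then path_len \<tau> (LEAST t. exposes (\<tau> t) A) / ennreal speed
      else \<infinity>)"

definition feasible ::
  "(real \<times> real) set \<Rightarrow> nat \<Rightarrow> (nat \<Rightarrow> real \<Rightarrow> real \<times> real) \<Rightarrow> bool" where
  "feasible D n \<tau> \<longleftrightarrow>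
     (\<forall>i<n. trajectory (\<tau> i)) \<and> (\<forall>A\<in>D. \<exists>i<n. \<exists>t. exposes (\<tau> i t) A)"

definition target_cost ::
  "nat \<Rightarrow> (nat \<Rightarrow> real) \<Rightarrow> (nat \<Rightarrow> real \<Rightarrow> real \<times> real) \<Rightarrow> real \<times> real \<Rightarrow> ennreal" where
  "target_cost n c \<tau> A = (INF i\<in>{..<n}. exposure_time (\<tau> i) (c i) A) / ennreal (norm A)"

definition search_cost ::
  "(real \<times> real) set \<Rightarrow> nat \<Rightarrow> (nat \<Rightarrow> real) \<Rightarrow> (nat \<Rightarrow> real \<Rightarrow> real \<times> real) \<Rightarrow> ennreal" where
  "search_cost D n c \<tau> = (SUP A\<in>D. target_cost n c \<tau> A)"

text \<open>For a trajectory, the least exposing parameter in \<^const>\<open>exposure_time\<close> is attained.\<close>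

lemma exposes_scale: "exposes P A \<Longrightarrow> A \<noteq> 0 \<and> (\<exists>s\<ge>1. P = s *\<^sub>R A)"
proof -
  assume "exposes P A"
  then obtain x y \<psi> where *: "y > 0" "x \<ge> y" "P = polar x \<psi>" "A = polar y \<psi>"
    unfolding exposes_def by blast
  have "(cos \<psi>, sin \<psi>) \<noteq> (0, 0)" using sin_zero_norm_cos_one[of \<psi>] by auto
  then have "A \<noteq> 0" using * by (auto simp: polar_def zero_prod_def)
  moreover have "x / y \<ge> 1" "P = (x / y) *\<^sub>R A" using * by (auto simp: polar_def)
  ultimately show ?thesis by blast
qed

lemma exposes_iff:
  assumes "A \<noteq> 0"
  shows "exposes P A \<longleftrightarrow> (\<exists>s\<ge>1. P = s *\<^sub>R A)"
proof
  assume "\<exists>s\<ge>1. P = s *\<^sub>R A"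
  then obtain s where s: "s \<ge> 1" "P = s *\<^sub>R A" by blast
  obtain a b where A: "A = (a, b)" by (cases A)
  define r where "r = sqrt (a\<^sup>2 + b\<^sup>2)"
  have pos: "a\<^sup>2 + b\<^sup>2 > 0"
    using assms A by (simp add: zero_prod_def sum_power2_gt_zero_iff)
  then have r: "r > 0" and rsq: "a\<^sup>2 + b\<^sup>2 = r\<^sup>2" by (simp_all add: r_def)
  have "(a / r)\<^sup>2 + (b / r)\<^sup>2 = r\<^sup>2 / r\<^sup>2"
    by (simp only: power_divide add_divide_distrib flip: rsq)
  then have "(a / r)\<^sup>2 + (b / r)\<^sup>2 = 1" using r by simp
  then obtain \<psi> where "a / r = cos \<psi>" "b / r = sin \<psi>"
    using sincos_total_2pi by metis
  then have A': "A = polar r \<psi>" using r A by (auto simp: polar_def field_simps)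
  then have "P = polar (s * r) \<psi>" using s by (simp add: polar_def)
  moreover have "s * r > 0" "s * r \<ge> r" using r s by auto
  ultimately show "exposes P A"
    using r A' unfolding exposes_def by blast
qed (use exposes_scale in blast)

lemma exposure_attained:
  assumes "trajectory \<tau>" and ex: "\<exists>t. exposes (\<tau> t) A"
  shows "exposes (\<tau> (LEAST t. exposes (\<tau> t) A)) A"
proof -
  have A: "A \<noteq> 0" using ex exposes_scale by blast
  define R where "R = (\<lambda>s. s *\<^sub>R A) ` {1..}"
  have "closed R"
    unfolding R_def using A
    by (intro closed_injective_linear_image) (auto simp: inj_on_def intro!: linearI simp: scaleR_add_left)
  define T where "T = {t. exposes (\<tau> t) A}"
  have T: "T = \<tau> -` R" unfolding T_def R_def exposes_iff[OF A] by auto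
  have "closed T"
    using assms(1) \<open>closed R\<close> unfolding T trajectory_def
    by (simp add: continuous_on_closed_vimage)
  have "((\<lambda>t. norm (\<tau> t)) \<longlongrightarrow> 0) at_bot"
    using assms(1) unfolding trajectory_def by (intro tendsto_norm_zero) (auto simp: zero_prod_def)
  then have "eventually (\<lambda>t. norm (\<tau> t) < norm A) at_bot"
    using A by (intro order_tendstoD(2)[of _ 0]) auto
  then obtain B where B: "\<And>t. t \<le> B \<Longrightarrow> norm (\<tau> t) < norm A"
    unfolding eventually_at_bot_linorder by blast
  have low: "B \<le> t" if "t \<in> T" for t
  proof (rule ccontr)
    assume "\<not> B \<le> t"
    moreover from that obtain s where "s \<ge> 1" "\<tau> t = s *\<^sub>R A" unfolding T R_def by auto
    ultimately show False using B[of t] A by simp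
  qed
  have "Inf T \<in> T"
    using ex low \<open>closed T\<close> by (intro closed_contains_Inf) (auto simp: T_def bdd_below_def)
  moreover have "Inf T \<le> t" if "t \<in> T" for t
    using that low by (intro cInf_lower) (auto simp: bdd_below_def)
  ultimately have "(LEAST t. exposes (\<tau> t) A) = Inf T"
    by (intro Least_equality) (auto simp: T_def)
  with \<open>Inf T \<in> T\<close> show ?thesis by (simp add: T_def)
qed

end

theory Submission
  imports Defs
begin

text \<open>All agents follow rotated copies of one logarithmic spiral \<open>r = exp (b \<theta>)\<close>, but unlike in the
  symmetric solution the rotations are matched to the speeds. On a fixed ray, let \<open>exp (b h\<^sub>i)\<close> be
  the ratio between the crossing radius of agent \<open>i\<close> and the preceding crossing radius. A target in this
  gap is found at relative cost below \<open>exp (b h\<^sub>i) / c\<^sub>i * sqrt (1 + b\<^sup>2) / b\<close>, so equal costs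
  need \<open>exp (b h\<^sub>i) = C c\<^sub>i\<close>, and one full turn needs \<open>\<Sum>h\<^sub>i = 2 \<pi>\<close>, which gives
  \<open>C = exp (2 \<pi> b / n) / GM\<close>, where \<open>GM\<close> is the geometric mean of the speeds. With
  \<open>b = kappa n\<close> the cost is \<open>unit_cost n / GM\<close>. Agents with \<open>C c\<^sub>i \<le> 1\<close> are too slow to help;
  replacing their \<open>h\<^sub>i\<close> by \<open>0\<close> only increases the sum, so the gaps still cover a full turn.\<close>

section \<open>Polar coordinates\<close>

lemma norm_polar [simp]: "norm (polar r \<phi>) = \<bar>r\<bar>"
  by (simp add: polar_def norm_Pair del: scaleR_Pair)

lemma polar_exists:
  assumes "A \<noteq> (0, 0)"
  obtains r \<psi> where "r > 0" "A = polar r \<psi>"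
proof -
  have "A \<noteq> 0" using assms by (simp add: zero_prod_def)
  then have "exposes A A" by (auto simp: exposes_iff intro!: exI[of _ 1])
  then show thesis using that unfolding exposes_def by blast
qed

lemma polar_eq_iff:
  assumes "r > 0" "s > 0"
  shows "polar r \<phi> = polar s \<psi> \<longleftrightarrow> r = s \<and> (\<exists>m::int. \<phi> = \<psi> + 2 * pi * m)"
proof -
  have "r = s" if "polar r \<phi> = polar s \<psi>"
    using arg_cong[OF that, of norm] assms by simp
  then show ?thesis
    using assms sin_cos_eq_iff[of \<phi> \<psi>] by (auto simp: polar_def)
qed

section \<open>Logarithmic spirals: exposed targets, arc length and exposure time\<close>

definition spiral :: "real \<Rightarrow> real \<Rightarrow> real \<Rightarrow> real \<times> real" where
  "spiral b a t = polar (exp (b * t)) (t + a)"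

lemma ln_le_iff_le_exp: "(0::real) < x \<Longrightarrow> ln x \<le> y \<longleftrightarrow> x \<le> exp y"
  using exp_le_cancel_iff[of "ln x" y] by simp

text \<open>The parameter is the polar angle minus \<open>a\<close>, so hitting the ray is a
  congruence modulo 2 \<pi>; after taking logarithms, the condition on the radius is linear in
  \<open>t\<close>.\<close>

lemma spiral_exposes_iff:
  assumes "r > 0"
  shows "exposes (spiral b a t) (polar r \<psi>) \<longleftrightarrow>
    ln r \<le> b * t \<and> (\<exists>m::int. t + a = \<psi> + 2 * pi * m)"
proof
  assume "exposes (spiral b a t) (polar r \<psi>)"
  then obtain x y \<omega> where *: "x > 0" "y > 0" "x \<ge> y"
    "spiral b a t = polar x \<omega>" "polar r \<psi> = polar y \<omega>"
    unfolding exposes_def by blast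
  then obtain m m' :: int where "exp (b * t) = x" "r = y"
    and "t + a = \<omega> + 2 * pi * m" "\<psi> = \<omega> + 2 * pi * m'"
    using assms unfolding spiral_def by (auto simp: polar_eq_iff)
  moreover from this have "t + a = \<psi> + 2 * pi * (m - m')"
    by (simp add: algebra_simps)
  ultimately show "ln r \<le> b * t \<and> (\<exists>m::int. t + a = \<psi> + 2 * pi * m)"
    using * by (metis exp_le_cancel_iff exp_ln of_int_diff)
next
  assume "ln r \<le> b * t \<and> (\<exists>m::int. t + a = \<psi> + 2 * pi * m)"
  then have "r \<le> exp (b * t)" "spiral b a t = polar (exp (b * t)) \<psi>"
    using assms by (auto simp: spiral_def polar_eq_iff ln_le_iff_le_exp)
  with assms show "exposes (spiral b a t) (polar r \<psi>)"
    unfolding exposes_def by (metis exp_gt_zero)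
qed

lemma spiral_has_vector_derivative:
  "(spiral b a has_vector_derivative
     exp (b * t) *\<^sub>R (b * cos (t + a) - sin (t + a), b * sin (t + a) + cos (t + a))) (at t)"
proof -
  have eq: "spiral b a = (\<lambda>t. (exp (b * t) * cos (t + a), exp (b * t) * sin (t + a)))"
    by (auto simp: spiral_def polar_def)
  show ?thesis
    unfolding eq
    by (rule has_vector_derivative_eq_rhs, rule has_vector_derivative_Pair)
       (auto intro!: derivative_eq_intros simp: algebra_simps
         simp flip: has_real_derivative_iff_has_vector_derivative)
qed

text \<open>The derivative is \<open>exp (b * t)\<close> times the vector \<open>(b, 1)\<close>
  rotated by \<open>t + a\<close>, and rotations preserve the norm.\<close>

lemma norm_vector_derivative_spiral:
  "norm (vector_derivative (spiral b a) (at t)) = sqrt (1 + b\<^sup>2) * exp (b * t)"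
proof -
  have "(b * cos x - sin x)\<^sup>2 + (b * sin x + cos x)\<^sup>2 = 1 + b\<^sup>2" for x
  proof -
    have "(b * cos x - sin x)\<^sup>2 + (b * sin x + cos x)\<^sup>2 = (1 + b\<^sup>2) * ((sin x)\<^sup>2 + (cos x)\<^sup>2)"
      by algebra
    then show ?thesis by simp
  qed
  then show ?thesis
    by (simp add: vector_derivative_at[OF spiral_has_vector_derivative] norm_Pair
        del: scaleR_Pair)
qed

lemma trajectory_spiral:
  assumes "b > 0"
  shows "trajectory (spiral b a)"
proof -
  have diff: "spiral b a differentiable at t" for t
    using spiral_has_vector_derivative by (rule differentiableI_vector)
  have cont: "continuous_on UNIV (spiral b a)"
    using diff by (simp add: continuous_at_imp_continuous_on differentiable_imp_continuous_within)
  have "((\<lambda>t. exp (b * t)) \<longlongrightarrow> 0) at_bot"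
    using assms by (intro filterlim_compose[OF exp_at_bot]
        filterlim_tendsto_pos_mult_at_bot[OF tendsto_const _ filterlim_ident])
  then have "(spiral b a \<longlongrightarrow> 0) at_bot"
    by (intro tendsto_norm_zero_cancel[of "spiral b a"]) (simp add: spiral_def)
  with cont diff show ?thesis
    unfolding trajectory_def
    by (auto simp: zero_prod_def differentiable_at_withinI differentiable_on_def
        intro!: differentiable_on_imp_piecewise_differentiable)
qed

text \<open>The integrand decays exponentially towards -\<infinity>, so the infinitely many inner
  turns have finite length, proportional to the radius reached.\<close>

lemma path_len_spiral:
  assumes "b > 0"
  shows "path_len (spiral b a) t = ennreal (sqrt (1 + b\<^sup>2) / b * exp (b * t))"
proof -
  define K where "K = sqrt (1 + b\<^sup>2)"
  have "path_len (spiral b a) t = (\<integral>\<^sup>+u. ennreal (K * exp (b * u)) * indicator {..t} u \<partial>lborel)"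
    unfolding path_len_def norm_vector_derivative_spiral K_def ..
  \<comment> \<open>Reflecting \<open>u\<close> gives a half-line unbounded above, where the
    fundamental theorem applies with an antiderivative vanishing at infinity.\<close>
  also have "\<dots> = (\<integral>\<^sup>+u. ennreal (K * exp (- b * u)) * indicator {- t..} u \<partial>lborel)"
    by (subst nn_integral_real_affine[of _ "-1" 0])
       (auto intro!: nn_integral_cong simp: indicator_def)
  also have "\<dots> = ennreal (0 - - K / b * exp (- b * - t))"
  proof (rule nn_integral_FTC_atLeast)
    have "((\<lambda>x. exp (- b * x)) \<longlongrightarrow> 0) at_top"
      using assms by (intro filterlim_compose[OF exp_at_bot]
        filterlim_tendsto_neg_mult_at_bot[OF tendsto_const _ filterlim_ident]) simp
    then show "((\<lambda>x. - K / b * exp (- b * x)) \<longlongrightarrow> 0) at_top"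
      by (rule tendsto_mult_right_zero)
    show "((\<lambda>x. - K / b * exp (- b * x)) has_real_derivative K * exp (- b * x)) (at x)" for x
      using assms by (auto intro!: derivative_eq_intros simp: field_simps)
  qed (auto simp: K_def)
  finally show ?thesis by (simp add: K_def)
qed

text \<open>Length grows with the parameter, so any exposing \<open>t\<close> gives a bound once the
  \<open>LEAST\<close> is identified, which is done by undoing full turns from
  \<open>t\<close>.\<close>

lemma exposure_time_spiral_le:
  assumes "b > 0" and r: "r > 0" and t: "exposes (spiral b a t) (polar r \<psi>)"
  shows "exposure_time (spiral b a) v (polar r \<psi>)
           \<le> ennreal (sqrt (1 + b\<^sup>2) / b * exp (b * t)) / ennreal v"
proof -
  define x where "x = ln r / b"
  have iff: "exposes (spiral b a s) (polar r \<psi>) \<longleftrightarrow> x \<le> s \<and> (\<exists>m::int. s + a = \<psi> + 2 * pi * m)" for s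
    unfolding spiral_exposes_iff[OF r] x_def using \<open>b > 0\<close> by (simp add: field_simps)
  \<comment> \<open>The spiral has radius \<open>r\<close> at parameter \<open>x\<close>;
    \<open>N\<close> is the number of full turns that can be undone from \<open>t\<close> before the
    radius drops below \<open>r\<close>.\<close>
  define N where "N = \<lfloor>(t - x) / (2 * pi)\<rfloor>"
  have N: "2 * pi * N \<le> t - x" "t - x < 2 * pi * (N + 1)"
    using floor_divide_lower[of "2 * pi" "t - x"] floor_divide_upper[of "2 * pi" "t - x"]
    unfolding N_def by (simp_all add: algebra_simps)
  obtain m :: int where m: "t + a = \<psi> + 2 * pi * m" "x \<le> t" using t iff by blast
  have "(LEAST s. exposes (spiral b a s) (polar r \<psi>)) = t - 2 * pi * N"
  proof (rule Least_equality)
    have "t - 2 * pi * N + a = \<psi> + 2 * pi * (m - N)"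
      using m by (simp add: algebra_simps)
    then show "exposes (spiral b a (t - 2 * pi * N)) (polar r \<psi>)"
      using N(1) unfolding iff by (intro conjI exI[of _ "m - N"]) simp_all
  next
    fix s assume "exposes (spiral b a s) (polar r \<psi>)"
    then obtain m' :: int where s: "s + a = \<psi> + 2 * pi * m'" "x \<le> s" using iff by blast
    \<comment> \<open>Exposing parameters are whole turns apart, and fewer than \<open>N + 1\<close>
      turns means at most \<open>N\<close>.\<close>
    have "2 * pi * (m - m') < 2 * pi * (N + 1)"
      using s m N(2) by (simp add: algebra_simps)
    then have "real_of_int (m - m') < real_of_int (N + 1)" by simp
    then have "m - m' \<le> N" by linarith
    then have "2 * pi * real_of_int (m - m') \<le> 2 * pi * N"
      by (intro mult_left_mono) (auto simp: of_int_le_iff simp del: of_int_diff)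
    then show "t - 2 * pi * N \<le> s" using s m by (simp add: algebra_simps)
  qed
  moreover have "0 \<le> N" unfolding N_def using m by simp
  then have "exp (b * (t - 2 * pi * N)) \<le> exp (b * t)" using \<open>b > 0\<close> by simp
  ultimately show ?thesis
    using t \<open>b > 0\<close> unfolding exposure_time_def
    by (auto simp: path_len_spiral intro!: divide_right_mono_ennreal ennreal_leI mult_left_mono
        divide_right_mono simp del: times_divide_eq_left)
qed

section \<open>Rotations whose gaps cover a full turn\<close>

lemma partial_sums_bracket:
  fixes h :: "nat \<Rightarrow> 'a::linordered_ab_group_add"
  assumes "0 \<le> y" "y < sum h {..<n}"
  shows "\<exists>i<n. sum h {..<i} \<le> y \<and> y < sum h {..<i} + h i"
  using assms(2)
proof (induction n)
  case (Suc n)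
  then show ?case
    by (cases "y < sum h {..<n}") (auto simp: less_Suc_eq not_less)
qed (use assms(1) in auto)

text \<open>When all spirals are at radius \<open>r\<close>, spiral \<open>i\<close> is ahead of the
  unrotated one by the partial sum of the gaps before it. The spiral whose gap contains the target's
  angle turns by less than \<open>h i\<close> to reach the ray, so its radius grows by a factor
  below \<open>exp (b * h i)\<close>.\<close>

lemma spirals_expose:
  fixes h :: "nat \<Rightarrow> real"
  assumes b: "b > 0" and r: "r > 0" and h: "(\<Sum>i<n. h i) \<ge> 2 * pi"
  shows "\<exists>i<n. \<exists>t. exposes (spiral b (\<Sum>j<i. h j) t) (polar r \<psi>) \<and> exp (b * t) < r * exp (b * h i)"
proof -
  define x where "x = ln r / b"
  define N where "N = \<lfloor>(\<psi> - x) / (2 * pi)\<rfloor>"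
  \<comment> \<open>The target's angle relative to the unrotated spiral at radius \<open>r\<close>,
    reduced to one turn.\<close>
  define y where "y = \<psi> - x - 2 * pi * N"
  have "0 \<le> y" "y < 2 * pi"
    using floor_divide_lower[of "2 * pi" "\<psi> - x"] floor_divide_upper[of "2 * pi" "\<psi> - x"]
    unfolding y_def N_def by (simp_all add: algebra_simps)
  then obtain i where i: "i < n" "(\<Sum>j<i. h j) \<le> y" "y < (\<Sum>j<i. h j) + h i"
    using partial_sums_bracket[of y h n] h by auto
  define t where "t = x + (y - (\<Sum>j<i. h j))"
  have bx: "b * x = ln r" using b by (simp add: x_def)
  have "b * x \<le> b * t" "b * t < b * (x + h i)" using b i by (simp_all add: t_def)
  then have "ln r \<le> b * t" and lt: "b * t < ln r + b * h i"
    by (simp_all add: bx distrib_left)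
  moreover have "t + (\<Sum>j<i. h j) = \<psi> + 2 * pi * (- N)" by (simp add: t_def y_def)
  ultimately have "exposes (spiral b (\<Sum>j<i. h j) t) (polar r \<psi>)"
    unfolding spiral_exposes_iff[OF r] by (metis of_int_minus)
  moreover have "exp (b * t) < r * exp (b * h i)"
    using lt r by (metis exp_add exp_less_cancel_iff exp_ln)
  ultimately show ?thesis using i by blast
qed

section \<open>Cost of the rotated spirals\<close>

lemma kappa_pos: "i \<ge> 1 \<Longrightarrow> kappa i > 0"
  using theI'[OF kappa_ex1] unfolding kappa_def by blast

lemma unit_cost_pos: "i \<ge> 1 \<Longrightarrow> unit_cost i > 0"
  using kappa_pos[of i] by (simp add: unit_cost_def add_pos_nonneg)

lemma spirals_target_cost:
  fixes c :: "nat \<Rightarrow> real"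
  assumes n: "n \<ge> 1" and b: "b > 0" and c: "\<And>i. i < n \<Longrightarrow> 0 < c i"
  defines "M \<equiv> sqrt (1 + b\<^sup>2) / b * exp (2 * pi * b / n) / (\<Prod>i<n. c i) powr (1 / real n)"
  shows "\<exists>\<tau>. feasible punctured_plane n \<tau> \<and>
           (\<forall>A\<in>punctured_plane. target_cost n c \<tau> A < ennreal M)"
proof -
  define GM where "GM = (\<Prod>i<n. c i) powr (1 / real n)"
  define C where "C = exp (2 * pi * b / n) / GM"
  define K where "K = sqrt (1 + b\<^sup>2) / b"
  have P: "(\<Prod>i<n. c i) > 0" by (rule prod_pos) (simp add: c)
  then have GM: "GM > 0" unfolding GM_def powr_gt_zero by (metis less_irrefl)
  then have C: "C > 0" by (simp add: C_def)
  have K: "K > 0" using b by (simp add: K_def add_pos_nonneg)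
  define h where "h i = max 0 (ln (C * c i) / b)" for i
  have "real n * ln GM = ln (\<Prod>i<n. c i)"
    using n P by (simp add: GM_def ln_powr)
  also have "\<dots> = (\<Sum>i<n. ln (c i))" by (intro ln_prod) (auto dest!: c)
  finally have GM_sum: "real n * ln GM = (\<Sum>i<n. ln (c i))" .
  \<comment> \<open>Dividing by \<open>GM\<close> in \<open>C\<close> cancels the product of the
    speeds, so the unclipped gaps \<open>ln (C * c i) / b\<close> add up to exactly one
    turn.\<close>
  have "(\<Sum>i<n. ln (C * c i)) = (\<Sum>i<n. ln C + ln (c i))"
    using C by (intro sum.cong refl ln_mult_pos) (auto dest: c)
  also have "\<dots> = real n * ln C + real n * ln GM"
    by (simp add: sum.distrib GM_sum)
  also have "ln C = 2 * pi * b / n - ln GM" using GM by (simp add: C_def ln_div)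
  also have "real n * \<dots> + real n * ln GM = 2 * pi * b" using n by (simp add: field_simps)
  finally have "2 * pi = (\<Sum>i<n. ln (C * c i) / b)"
    using b by (simp flip: sum_divide_distrib)
  also have "\<dots> \<le> (\<Sum>i<n. h i)" unfolding h_def by (intro sum_mono) auto
  finally have h: "2 * pi \<le> (\<Sum>i<n. h i)" .
  define \<tau> where "\<tau> i = spiral b (\<Sum>j<i. h j)" for i
  \<comment> \<open>One agent witnesses both feasibility and the cost bound.\<close>
  have main: "\<exists>i<n. (\<exists>t. exposes (\<tau> i t) A) \<and>
      exposure_time (\<tau> i) (c i) A / ennreal (norm A) < ennreal M"
    if A: "A \<in> punctured_plane" for A
  proof -
    obtain r \<psi> where r: "r > 0" and A': "A = polar r \<psi>"
      using A polar_exists[of A] by (auto simp: punctured_plane_def)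
    obtain i t where i: "i < n" and ex: "exposes (\<tau> i t) A"
      and lt: "exp (b * t) < r * exp (b * h i)"
      using spirals_expose[OF b r h] unfolding \<tau>_def A' by blast
    have ge: "r \<le> exp (b * t)"
      using ex r unfolding \<tau>_def A' spiral_exposes_iff[OF r] by (simp add: ln_le_iff_le_exp)
    \<comment> \<open>The finding agent cannot have a clipped gap: \<open>h i = 0\<close> would put
      its radius below \<open>r\<close>. Hence its gap has the exact value matched to its
      speed.\<close>
    have "h i > 0"
    proof (rule ccontr)
      assume "\<not> h i > 0"
      then have "h i = 0" by (simp add: h_def max_def split: if_splits)
      with lt ge show False by simp
    qed
    then have "h i = ln (C * c i) / b" by (simp add: h_def max_def split: if_splits)
    then have eh: "exp (b * h i) = C * c i" using b C c[OF i] by simp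
    have "exposure_time (\<tau> i) (c i) A / ennreal (norm A)
        \<le> ennreal (K * exp (b * t)) / ennreal (c i) / ennreal r"
      using exposure_time_spiral_le[OF b r ex[unfolded \<tau>_def A'], of "c i"] r
      unfolding \<tau>_def A' K_def by (simp add: divide_right_mono_ennreal)
    also have "\<dots> = ennreal (K * exp (b * t) / c i / r)"
      using K c[OF i] r by (simp add: divide_ennreal)
    also have "\<dots> < ennreal M"
    proof (rule ennreal_lessI)
      have "K * exp (b * t) / c i / r < K * (r * (C * c i)) / c i / r"
        using lt K c[OF i] r unfolding eh
        by (intro divide_strict_right_mono mult_strict_left_mono)
      also have "\<dots> = K * C" using c[OF i] r by simp
      also have "\<dots> = M" by (simp add: M_def K_def C_def GM_def)
      finally show "K * exp (b * t) / c i / r < M" .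
      show "0 < M" using K C by (simp add: \<open>K * C = M\<close> [symmetric])
    qed
    finally show ?thesis using i ex by blast
  qed
  have "target_cost n c \<tau> A < ennreal M" if A: "A \<in> punctured_plane" for A
  proof -
    obtain i where i: "i < n"
      and lt: "exposure_time (\<tau> i) (c i) A / ennreal (norm A) < ennreal M"
      using main[OF A] by blast
    have "target_cost n c \<tau> A \<le> exposure_time (\<tau> i) (c i) A / ennreal (norm A)"
      unfolding target_cost_def using i by (intro divide_right_mono_ennreal INF_lower) simp
    with lt show ?thesis by order
  qed
  moreover have "feasible punctured_plane n \<tau>"
    unfolding feasible_def \<tau>_def
    using main[unfolded \<tau>_def] trajectory_spiral[OF b] by meson
  ultimately show ?thesis by blast
qed

theorem corollary1:
  fixes k n :: nat and c :: "nat \<Rightarrow> real"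
  assumes k: "1 \<le> k" and kn: "k \<le> n"
    and speeds_pos: "\<And>i. i < n \<Longrightarrow> 0 < c i"
    and speed0: "c 0 = 1"
    and speeds_decr: "\<And>i j. i \<le> j \<Longrightarrow> j < n \<Longrightarrow> c j \<le> c i"
    and geometric_mean: "(\<Prod>i<n. c i) powr (1 / real n) \<ge> unit_cost n / unit_cost k"
  shows "\<exists>\<tau>. feasible punctured_plane n \<tau>
           \<and> search_cost punctured_plane n c \<tau> \<le> ennreal (unit_cost k)
           \<and> (\<forall>A\<in>punctured_plane. target_cost n c \<tau> A < ennreal (unit_cost k))
           \<and> ((\<Prod>i<n. c i) powr (1 / real n) > unit_cost n / unit_cost k
                \<longrightarrow> search_cost punctured_plane n c \<tau> < ennreal (unit_cost k))"
proof -
  define GM where "GM = (\<Prod>i<n. c i) powr (1 / real n)"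
  define M where "M = unit_cost n / GM"
  have n: "1 \<le> n" using k kn by simp
  have "(\<Prod>i<n. c i) > 0" by (rule prod_pos) (simp add: speeds_pos)
  then have GM: "GM > 0" unfolding GM_def powr_gt_zero by (metis less_irrefl)
  note uk = unit_cost_pos[OF k]
  obtain \<tau> where feas: "feasible punctured_plane n \<tau>"
    and cost: "\<And>A. A \<in> punctured_plane \<Longrightarrow> target_cost n c \<tau> A < ennreal M"
    \<comment> \<open>With \<open>b = kappa n\<close>, the constant in front of the division by
      \<open>GM\<close> is \<open>unit_cost n\<close>.\<close>
    using spirals_target_cost[OF n kappa_pos[OF n], of c] speeds_pos
    unfolding M_def GM_def unit_cost_def by blast
  have le: "M \<le> unit_cost k"
    using geometric_mean GM uk by (simp add: M_def GM_def[symmetric] field_simps)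
  \<comment> \<open>The strict bound for each target becomes weak in the supremum; strictness
    returns below when \<open>M\<close> itself is less than \<open>unit_cost k\<close>.\<close>
  have sc: "search_cost punctured_plane n c \<tau> \<le> ennreal M"
    unfolding search_cost_def using cost by (intro SUP_least) (simp add: less_imp_le)
  have "search_cost punctured_plane n c \<tau> < ennreal (unit_cost k)"
    if "GM > unit_cost n / unit_cost k"
  proof -
    have "M < unit_cost k" using that GM uk by (simp add: M_def field_simps)
    then have "ennreal M < ennreal (unit_cost k)" using uk by (rule ennreal_lessI[rotated])
    with sc show ?thesis by order
  qed
  then show ?thesis
    using feas sc cost ennreal_leI[OF le] unfolding GM_def
    by (meson order_trans less_le_trans)
qed

end
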